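(* A domain $\Omega\subseteq\mathbb{R}^N$ is convex if and only if it has a continuous, convex exhaustion function.
   Context: A domain is a connected open set. $\Omega$ is convex if for all $P,Q\in\Omega$ the closed segment $\{(1-t)P+tQ:0\le t\le 1\}$ lies in $\Omega$. A function $\lambda:\Omega\to\mathbb{R}$ is an exhaustion function if for each $c\in\mathbb{R}$ the set $\{x\in\Omega:\lambda(x)\le c\}$ is a compact subset of $\Omega$. A function $F:\Omega\to\mathbb{R}$ is convex if $F((1-t)P+tQ)\le(1-t)F(P)+tF(Q)$ for all $0\le t\le 1$ and all $P,Q\in\Omega$ such that the closed segment from $P$ to $Q$ lies in $\Omega$ (when $\Omega$ is convex, this is the usual notion). *)

theory Defs
  imports "HOL-Analysis.Analysis"
begin

definition exhaustion_function :: "'a::topological_space set \<Rightarrow> ('a \<Rightarrow> real) \<Rightarrow> bool" where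
  "exhaustion_function \<Omega> f \<longleftrightarrow> (\<forall>c. compact {x \<in> \<Omega>. f x \<le> c})"

text \<open>
  Convexity of a function on a set that need not itself be convex: the inequality is required
  only along segments contained in the set.  The library predicate \<^const>\<open>convex_on\<close> is not
  suitable here, since it includes convexity of the underlying set.
\<close>

definition convex_along_segments :: "'a::real_vector set \<Rightarrow> ('a \<Rightarrow> real) \<Rightarrow> bool" where
  "convex_along_segments \<Omega> f \<longleftrightarrow>
    (\<forall>P\<in>\<Omega>. \<forall>Q\<in>\<Omega>. closed_segment P Q \<subseteq> \<Omega> \<longrightarrow>
      (\<forall>t. 0 \<le> t \<and> t \<le> 1 \<longrightarrow>
        f ((1 - t) *\<^sub>R P + t *\<^sub>R Q) \<le> (1 - t) * f P + t * f Q))"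

end

theory Submission
  imports Defs
begin

text \<open>
  If \<open>\<Omega>\<close> is convex, then the distance to the complement is concave on \<open>\<Omega>\<close>, so the sum of the norm and
  the reciprocal of that distance is a convex exhaustion function.  Conversely, given a convex
  exhaustion function \<open>f\<close> and \<open>P \<in> \<Omega>\<close>, the set of all \<open>Q \<in> \<Omega>\<close> whose segment to \<open>P\<close> stays in \<open>\<Omega>\<close> is
  open; it is closed in \<open>\<Omega>\<close> because, by convexity, such segments stay in a fixed compact sublevel set
  of \<open>f\<close> as \<open>Q\<close> tends to a point of \<open>\<Omega>\<close>.  By connectedness it is all of \<open>\<Omega>\<close>.
\<close>

text \<open>The open balls of radius \<open>a\<close> about \<open>P\<close> and \<open>b\<close>
  about \<open>Q\<close> lie in \<open>S\<close>; by convexity so do all weighted averages of their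
  points, which fill the ball of radius \<open>r\<close> about \<open>c\<close>.\<close>

lemma infdist_Compl_concave:
  fixes S :: "'a::real_normed_vector set"
  assumes "convex S" "S \<noteq> UNIV" "P \<in> S" "Q \<in> S" "0 \<le> t" "t \<le> 1"
  shows "(1 - t) * infdist P (- S) + t * infdist Q (- S)
    \<le> infdist ((1 - t) *\<^sub>R P + t *\<^sub>R Q) (- S)"
proof -
  define a b c where "a = infdist P (- S)" and "b = infdist Q (- S)"
    and "c = (1 - t) *\<^sub>R P + t *\<^sub>R Q"
  define r where "r = (1 - t) * a + t * b"
  have nonneg: "0 \<le> a" "0 \<le> b" by (auto simp: a_def b_def infdist_nonneg)
  have inside: "x + v \<in> S" if "norm v < infdist x (- S)" for x v
  proof (rule ccontr)
    assume "x + v \<notin> S"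
    then have "infdist x (- S) \<le> dist x (x + v)" by (intro infdist_le) simp
    with that show False by (simp add: dist_norm)
  qed
  have "r \<le> dist c z" if "z \<in> - S" for z
  proof (rule ccontr)
    assume "\<not> r \<le> dist c z"
    then have less: "norm (z - c) < r" by (simp add: dist_norm norm_minus_commute)
    then have r: "0 < r" by (meson norm_ge_zero order.strict_trans1)
    \<comment> \<open>One direction \<open>w\<close> serves both balls: moving \<open>P\<close> by
      \<open>a\<close> times \<open>w\<close> and \<open>Q\<close> by \<open>b\<close> times
      \<open>w\<close> stays in \<open>S\<close>, and the average of the two points is exactly
      \<open>z\<close>.\<close>
    define w where "w = (1 / r) *\<^sub>R (z - c)"
    have w: "norm w < 1" using less r by (simp add: w_def divide_simps)
    have shift: "x + infdist x (- S) *\<^sub>R w \<in> S" if "x \<in> S" for x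
    \<comment> \<open>\<open>inside\<close> needs a strict inequality, so a zero distance, possible
      since \<open>S\<close> may fail to be open, is treated apart; there the shift is
      trivial.\<close>
    proof (cases "infdist x (- S) = 0")
      case False
      then have "0 < infdist x (- S)" using infdist_nonneg[of x "- S"] by linarith
      then show ?thesis using w by (intro inside) simp
    qed (use that in simp)
    have "(1 - t) *\<^sub>R (P + a *\<^sub>R w) + t *\<^sub>R (Q + b *\<^sub>R w) = c + r *\<^sub>R w"
      by (simp add: c_def r_def algebra_simps)
    also have "\<dots> = z" using r by (simp add: w_def)
    finally have "z \<in> S"
      using assms shift[of P] shift[of Q] convexD[of S "P + a *\<^sub>R w" "Q + b *\<^sub>R w" "1 - t" t]
      by (simp add: a_def b_def)
    with that show False by simp
  qed
  then have "r \<le> infdist c (- S)"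
    using assms(2) by (auto simp: infdist_def intro!: cINF_greatest)
  then show ?thesis by (simp add: a_def b_def c_def r_def)
qed

lemma inverse_convex_combination_le:
  fixes a b t :: real
  assumes "0 < a" "0 < b" "0 \<le> t" "t \<le> 1"
  shows "inverse ((1 - t) * a + t * b) \<le> (1 - t) * inverse a + t * inverse b"
  using convex_onD[OF convex_on_inverse[of "{0<..}"], of t a b] assms by simp

lemma infdist_Compl_pos:
  assumes "open S" "S \<noteq> UNIV" "x \<in> S"
  shows "0 < infdist x (- S)"
  using assms by (intro infdist_pos_not_in_closed) auto

text \<open>For \<open>S = UNIV\<close> both \<^const>\<open>infdist\<close> to the empty set and \<open>inverse 0\<close> are zero, so only the norm remains.\<close>

definition boundary_exhaustion :: "'a::real_normed_vector set \<Rightarrow> 'a \<Rightarrow> real" where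
  "boundary_exhaustion S x = norm x + inverse (infdist x (- S))"

lemma continuous_on_boundary_exhaustion:
  assumes "open S"
  shows "continuous_on S (boundary_exhaustion S)"
proof (cases "S = UNIV")
  case True
  then show ?thesis by (simp add: boundary_exhaustion_def infdist_def continuous_intros)
next
  case False
  then show ?thesis unfolding boundary_exhaustion_def
    using infdist_Compl_pos[OF assms False] by (force intro!: continuous_intros)
qed

lemma convex_boundary_exhaustion:
  assumes "open S" "convex S"
  shows "convex_along_segments S (boundary_exhaustion S)"
  unfolding convex_along_segments_def
proof (intro ballI impI allI)
  fix P Q :: 'a and t :: real assume PQ: "P \<in> S" "Q \<in> S" and "0 \<le> t \<and> t \<le> 1"
  then have t: "0 \<le> t" "t \<le> 1" by auto
  let ?c = "(1 - t) *\<^sub>R P + t *\<^sub>R Q" and ?d = "\<lambda>x. infdist x (- S)"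
  have norm: "norm ?c \<le> (1 - t) * norm P + t * norm Q"
    using norm_triangle_ineq[of "(1 - t) *\<^sub>R P" "t *\<^sub>R Q"] t by simp
  have "inverse (?d ?c) \<le> (1 - t) * inverse (?d P) + t * inverse (?d Q)"
  proof (cases "S = UNIV")
    case False
    have pos: "0 < ?d P" "0 < ?d Q"
      using infdist_Compl_pos[OF assms(1) False] PQ by auto
    \<comment> \<open>\<open>inverse\<close> reverses order only among positive reals; the
      positivity comes from convexity of the open half-line.\<close>
    have "0 < (1 - t) * ?d P + t * ?d Q"
      using convexD[OF convex_real_interval(3), of "?d P" 0 "?d Q" "1 - t" t] pos t by simp
    then have "inverse (?d ?c) \<le> inverse ((1 - t) * ?d P + t * ?d Q)"
      using infdist_Compl_concave[OF assms(2) False PQ t] by (intro le_imp_inverse_le)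
    also have "\<dots> \<le> (1 - t) * inverse (?d P) + t * inverse (?d Q)"
      using pos t by (rule inverse_convex_combination_le)
    finally show ?thesis .
  qed (simp add: infdist_def)
  with norm show "boundary_exhaustion S ?c
      \<le> (1 - t) * boundary_exhaustion S P + t * boundary_exhaustion S Q"
    by (simp add: boundary_exhaustion_def algebra_simps)
qed

lemma exhaustion_boundary_exhaustion:
  fixes S :: "'a::{real_normed_vector,heine_borel} set"
  assumes "open S"
  shows "exhaustion_function S (boundary_exhaustion S)"
  unfolding exhaustion_function_def
proof
  fix c
  let ?L = "{x \<in> S. boundary_exhaustion S x \<le> c}" and ?d = "\<lambda>x. infdist x (- S)"
  have "norm x \<le> c" if "x \<in> ?L" for x
  proof -
    have "0 \<le> inverse (?d x)" by (simp add: infdist_nonneg)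
    with that show ?thesis unfolding boundary_exhaustion_def mem_Collect_eq by linarith
  qed
  then have "bounded ?L" by (auto simp: bounded_iff)
  moreover have "closed ?L"
  proof (cases "S = UNIV")
    case True
    then have "?L = cball 0 c" by (auto simp: boundary_exhaustion_def infdist_def)
    then show ?thesis by simp
  next
    case False
    \<comment> \<open>Clearing the denominator gives an inequality between functions continuous on
      the whole space. Off \<open>S\<close> it reads 1 \<le> 0, so its solution set is
      \<open>?L\<close>, which is thus closed in the whole space and not merely in
      \<open>S\<close>.\<close>
    have "boundary_exhaustion S x \<le> c \<longleftrightarrow> norm x * ?d x + 1 \<le> c * ?d x" if "x \<in> S" for x
      using infdist_Compl_pos[OF assms False that]
      by (simp add: boundary_exhaustion_def field_simps)
    moreover have "\<not> norm x * ?d x + 1 \<le> c * ?d x" if "x \<notin> S" for x using that by simp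
    ultimately have "?L = {x. norm x * ?d x + 1 \<le> c * ?d x}" by blast
    then show ?thesis by (simp add: closed_Collect_le continuous_intros)
  qed
  ultimately show "compact ?L" by (simp add: compact_eq_bounded_closed)
qed

text \<open>A compact segment inside an open set has a uniform \<open>e\<close>-neighbourhood there,
  and moving one endpoint by less than \<open>e\<close> moves no point of the segment
  further.\<close>

lemma open_segment_visible:
  fixes S :: "'a::real_normed_vector set"
  assumes "open S"
  shows "open {Q. closed_segment P Q \<subseteq> S}"
  unfolding open_dist
proof (intro ballI)
  fix Q assume "Q \<in> {Q. closed_segment P Q \<subseteq> S}"
  then obtain e where e: "0 < e" "(\<Union>x\<in>closed_segment P Q. ball x e) \<subseteq> S"
    using compact_subset_open_imp_ball_epsilon_subset[OF compact_segment assms]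
    by (metis mem_Collect_eq)
  have "R \<in> {Q. closed_segment P Q \<subseteq> S}" if R: "dist R Q < e" for R
  proof (clarsimp simp: in_segment)
    fix t :: real assume t: "0 \<le> t" "t \<le> 1"
    have "dist ((1 - t) *\<^sub>R P + t *\<^sub>R Q) ((1 - t) *\<^sub>R P + t *\<^sub>R R) = t * dist R Q"
      using t by (simp add: dist_norm norm_minus_commute flip: scaleR_diff_right)
    also have "\<dots> \<le> dist R Q" using t by (simp add: mult_left_le_one_le)
    finally show "(1 - t) *\<^sub>R P + t *\<^sub>R R \<in> S"
      using t R by (intro subsetD[OF e(2)]) (force simp: in_segment)
  qed
  with e(1) show "\<exists>e>0. \<forall>R. dist R Q < e \<longrightarrow> R \<in> {Q. closed_segment P Q \<subseteq> S}" by blast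
qed

lemma closed_segment_subset_limit:
  fixes S :: "'a::real_normed_vector set"
  assumes f: "continuous_on S f" "convex_along_segments S f" "exhaustion_function S f"
    and P: "P \<in> S" and Q: "Q \<in> S" "q \<longlonglongrightarrow> Q" "\<And>n. q n \<in> S"
    and seg: "\<And>n. closed_segment P (q n) \<subseteq> S"
  shows "closed_segment P Q \<subseteq> S"
proof
  fix x assume "x \<in> closed_segment P Q"
  then obtain t where t: "0 \<le> t" "t \<le> 1" and x: "x = (1 - t) *\<^sub>R P + t *\<^sub>R Q"
    by (auto simp: in_segment)
  let ?p = "\<lambda>n. (1 - t) *\<^sub>R P + t *\<^sub>R q n"
  have "(\<lambda>n. f (q n)) \<longlonglongrightarrow> f Q"
    using continuous_on_tendsto_compose[OF f(1) Q(2,1)] Q(3) by simp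
  then have "Bseq (\<lambda>n. f (q n))" by (intro convergent_imp_Bseq convergentI)
  then obtain K where K: "\<And>n. \<bar>f (q n)\<bar> \<le> K" by (auto simp: Bseq_def)
  \<comment> \<open>\<open>M\<close> bounds \<open>f\<close> at both ends of every segment, hence
    along it, independently of \<open>n\<close>.\<close>
  define M where "M = max (f P) K"
  have "?p n \<in> {y \<in> S. f y \<le> M}" for n
  proof -
    have "?p n \<in> closed_segment P (q n)" using t by (auto simp: in_segment)
    moreover have "f (?p n) \<le> (1 - t) * f P + t * f (q n)"
      using f(2) P Q(3) seg t unfolding convex_along_segments_def by blast
    moreover have "(1 - t) * f P + t * f (q n) \<le> M"
      using K[of n] t by (intro convex_bound_le) (auto simp: M_def)
    ultimately show ?thesis using seg[of n] by auto
  qed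
  \<comment> \<open>Closedness in the whole space is what forces the limit \<open>x\<close> into
    \<open>S\<close>.\<close>
  moreover have "closed {y \<in> S. f y \<le> M}"
    using f(3) by (auto simp: exhaustion_function_def intro: compact_imp_closed)
  moreover have "?p \<longlonglongrightarrow> x" unfolding x by (intro tendsto_intros Q(2))
  ultimately have "x \<in> {y \<in> S. f y \<le> M}" by (metis (lifting) closed_sequentially)
  then show "x \<in> S" by simp
qed

lemma convex_exhaustion_imp_convex:
  fixes S :: "'a::real_normed_vector set"
  assumes "open S" "connected S"
    and f: "continuous_on S f" "convex_along_segments S f" "exhaustion_function S f"
  shows "convex S"
  unfolding convex_contains_segment
proof
  fix P assume P: "P \<in> S"
  let ?A = "{Q \<in> S. closed_segment P Q \<subseteq> S}"
  have "openin (top_of_set S) ?A"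
    using openin_open_Int[OF open_segment_visible[OF assms(1), of P], of S]
    by (simp add: Int_def)
  moreover have "closedin (top_of_set S) ?A"
    \<comment> \<open>Only limit points \<open>Q\<close> in \<open>S\<close> matter, so
      \<open>f\<close> is continuous at \<open>Q\<close> and its values along \<open>q\<close> stay
      bounded.\<close>
    unfolding closedin_limpt
  proof (intro conjI allI impI)
    fix Q assume "Q islimpt ?A \<and> Q \<in> S"
    then obtain q where "\<And>n. q n \<in> ?A" "q \<longlonglongrightarrow> Q" and Q: "Q \<in> S"
      by (auto simp: islimpt_sequential)
    then show "Q \<in> ?A" using closed_segment_subset_limit[OF f P Q, of q] by auto
  qed auto
  moreover have "P \<in> ?A" using P by simp
  ultimately have "?A = S" using assms(2) unfolding connected_clopen by blast
  then show "\<forall>Q\<in>S. closed_segment P Q \<subseteq> S" by blast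
qed

theorem theorem9:
  fixes \<Omega> :: "(real ^ 'n) set"
  assumes "open \<Omega>" and "connected \<Omega>"
  shows "convex \<Omega> \<longleftrightarrow>
    (\<exists>f :: real ^ 'n \<Rightarrow> real.
      continuous_on \<Omega> f \<and> convex_along_segments \<Omega> f \<and> exhaustion_function \<Omega> f)"
  using continuous_on_boundary_exhaustion[OF assms(1)] convex_boundary_exhaustion[OF assms(1)]
    exhaustion_boundary_exhaustion[OF assms(1)] convex_exhaustion_imp_convex[OF assms]
  by blast

end
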